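(* Let $P\subset\mathbb{R}^2$ be the lattice polygon with vertices $(0,0),(1,1),(0,2)$, let $X$ be the non-singular toric surface over $\mathbb{F}_q$ whose complete fan has rays generated by $v(\rho_1)=(1,0)$, $v(\rho_2)=(-1,1)$, $v(\rho_3)=(-1,0)$, $v(\rho_4)=(-1,-1)$, and let $D=V(\rho_3)+2V(\rho_4)$, so that $P_D=P$ and $\mathrm{vol}_2(P_D)=1$. Let $\mathcal{C}_P$ be the associated toric code over $\mathbb{F}_q$, of length $n=(q-1)^2$ and minimum distance $d$. Then for every prime power $q\ge 5$, the integer $N=q-2>1$ satisfies $$2N\,\mathrm{vol}_2(P_D)\le n\le 2N^2\,\mathrm{vol}_2(P_D),$$ while $d=(q-1)^2-2(q-1)$, so that $$d< n-2N\,\mathrm{vol}_2(P_D).$$ In particular, Joyner's conjecture (stated in the context) that $d\ge n-2N\,\mathrm{vol}_r(P_D)$ for $q$ sufficiently large is false.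
   Context: For a torus-invariant divisor $D=\sum_\rho d_\rho V(\rho)$ on a complete toric variety with primitive ray generators $v(\rho)\in\mathbb{Z}^r$, $P_D=\{u\in\mathbb{R}^r\mid\langle u,v(\rho)\rangle\ge-d_\rho\ \text{for all }\rho\}$, and $\mathrm{H}^0(X,\mathcal{O}(D))$ is the $\mathbb{F}_q$-vector space of Laurent polynomials in $t_1,\ldots,t_r$ with basis the monomials $\chi^u=t_1^{u_1}\cdots t_r^{u_r}$, $u\in P_D\cap\mathbb{Z}^r$. The toric code $\mathcal{C}_P$, with $P=P_D$, is the image of $f\mapsto(f(t))_{t\in T}$, $f\in\mathrm{H}^0(X,\mathcal{O}(D))$, where $T=(\mathbb{F}_q^\ast)^r$; its minimum distance is the least number of nonzero coordinates of a nonzero codeword. $\mathrm{vol}_r$ is Lebesgue volume. Joyner's conjecture: let $X$ be a non-singular toric variety of dimension $r$, $D$ a torus-invariant Cartier divisor, and let $n$ (the code length) be so large that there is an integer $N>1$ with $2N\,\mathrm{vol}_r(P_D)\le n\le 2N^2\,\mathrm{vol}_r(P_D)$. If $q$ is sufficiently large (depending possibly on the geometric data but not on $f$), then any $f\in\mathrm{H}^0(X,\mathcal{O}(D))$ has no more than $n$ zeros in the rational points of $X$, and consequently the minimum distance satisfies $d\ge n-2N\,\mathrm{vol}_r(P_D)$. *)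

theory Defs
  imports "HOL-Analysis.Analysis" "HOL-Algebra.Ring"
begin

section \<open>Lattices, cones and fans\<close>

text \<open>The lattice is \<open>int ^ 'n\<close>, with \<open>'n\<close> of cardinality \<open>r\<close>; cones and polytopes live in
  \<open>real ^ 'n\<close>.\<close>

definition rvec :: "int ^ 'n \<Rightarrow> real ^ 'n" where
  "rvec u = (\<chi> i. real_of_int (u $ i))"

definition primitive :: "int ^ 'n \<Rightarrow> bool" where
  "primitive v \<longleftrightarrow> Gcd (range (($) v)) = 1"

definition lattice_basis :: "(int ^ 'n) set \<Rightarrow> bool" where
  "lattice_basis B \<longleftrightarrow> finite B \<and>
     (\<forall>u. \<exists>!c. (\<forall>b. b \<notin> B \<longrightarrow> c b = 0) \<and> u = (\<Sum>b\<in>B. c b *s b))"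

definition lattice_cone :: "(int ^ 'n) set \<Rightarrow> (real ^ 'n) set" where
  "lattice_cone S = convex_cone hull (rvec ` S)"

text \<open>The library's \<open>face_of\<close> also admits the empty face, which is not a cone.\<close>

definition fan :: "(real ^ 'n) set set \<Rightarrow> bool" where
  "fan \<Delta> \<longleftrightarrow> finite \<Delta> \<and> \<Delta> \<noteq> {} \<and>
     (\<forall>\<sigma>\<in>\<Delta>. (\<exists>S. finite S \<and> \<sigma> = lattice_cone S) \<and> \<sigma> \<inter> uminus ` \<sigma> = {0}) \<and>
     (\<forall>\<sigma>\<in>\<Delta>. \<forall>\<tau>. \<tau> face_of \<sigma> \<and> \<tau> \<noteq> {} \<longrightarrow> \<tau> \<in> \<Delta>) \<and>
     (\<forall>\<sigma>\<in>\<Delta>. \<forall>\<tau>\<in>\<Delta>. \<sigma> \<inter> \<tau> face_of \<sigma> \<and> \<sigma> \<inter> \<tau> face_of \<tau>)"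

definition complete_fan :: "(real ^ 'n) set set \<Rightarrow> bool" where
  "complete_fan \<Delta> \<longleftrightarrow> fan \<Delta> \<and> \<Union>\<Delta> = UNIV"

text \<open>A toric variety is non-singular iff every cone of its fan is generated by part of a
  lattice basis.\<close>

definition smooth_fan :: "(real ^ 'n) set set \<Rightarrow> bool" where
  "smooth_fan \<Delta> \<longleftrightarrow> fan \<Delta> \<and>
     (\<forall>\<sigma>\<in>\<Delta>. \<exists>B S. lattice_basis B \<and> S \<subseteq> B \<and> \<sigma> = lattice_cone S)"

text \<open>Rays are identified with their primitive generators.\<close>

definition ray_generators :: "(real ^ 'n) set set \<Rightarrow> (int ^ 'n) set" where
  "ray_generators \<Delta> = {v. primitive v \<and> lattice_cone {v} \<in> \<Delta>}"


section \<open>Torus-invariant divisors\<close>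

text \<open>A torus-invariant divisor is given by its coefficients at the ray generators; the values
  of the function elsewhere are irrelevant.\<close>

type_synonym 'n divisor = "int ^ 'n \<Rightarrow> int"

definition prime_divisor :: "int ^ 'n \<Rightarrow> 'n divisor" where
  "prime_divisor v = (\<lambda>w. if w = v then 1 else 0)"

text \<open>On the affine chart of a cone \<open>\<sigma>\<close> a torus-invariant Cartier divisor is the divisor of a
  character \<open>m\<close> (up to the usual sign).\<close>

definition cartier :: "(real ^ 'n) set set \<Rightarrow> 'n divisor \<Rightarrow> bool" where
  "cartier \<Delta> D \<longleftrightarrow> (\<forall>\<sigma>\<in>\<Delta>. \<exists>m :: int ^ 'n. \<forall>v\<in>ray_generators \<Delta>.
     rvec v \<in> \<sigma> \<longrightarrow> (\<Sum>i\<in>UNIV. m $ i * v $ i) = - D v)"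

definition divisor_polytope :: "(real ^ 'n) set set \<Rightarrow> 'n divisor \<Rightarrow> (real ^ 'n) set" where
  "divisor_polytope \<Delta> D = {u. \<forall>v\<in>ray_generators \<Delta>. u \<bullet> rvec v \<ge> - real_of_int (D v)}"


section \<open>Toric codes\<close>

text \<open>A Laurent polynomial is its finitely supported coefficient function on exponent vectors.
  For \<open>P = divisor_polytope \<Delta> D\<close> the set below is \<open>H\<^sup>0(X, O(D))\<close>.\<close>

definition global_sections :: "('a, 'b) ring_scheme \<Rightarrow> (real ^ 'n) set \<Rightarrow> (int ^ 'n \<Rightarrow> 'a) set" where
  "global_sections F P = {f. (\<forall>u. f u \<in> carrier F) \<and> finite {u. f u \<noteq> \<zero>\<^bsub>F\<^esub>} \<and>
     (\<forall>u. f u \<noteq> \<zero>\<^bsub>F\<^esub> \<longrightarrow> rvec u \<in> P)}"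

definition torus_points :: "('a, 'b) ring_scheme \<Rightarrow> ('n \<Rightarrow> 'a) set" where
  "torus_points F = {t. \<forall>i. t i \<in> carrier F - {\<zero>\<^bsub>F\<^esub>}}"

definition monomial_at ::
    "('a, 'b) ring_scheme \<Rightarrow> int ^ 'n \<Rightarrow> ('n::finite \<Rightarrow> 'a) \<Rightarrow> 'a" where
  "monomial_at F u t = finprod F (\<lambda>i. t i [^]\<^bsub>F\<^esub> (u $ i)) UNIV"

definition laurent_eval ::
    "('a, 'b) ring_scheme \<Rightarrow> (int ^ 'n \<Rightarrow> 'a) \<Rightarrow> ('n::finite \<Rightarrow> 'a) \<Rightarrow> 'a" where
  "laurent_eval F f t = finsum F (\<lambda>u. f u \<otimes>\<^bsub>F\<^esub> monomial_at F u t) {u. f u \<noteq> \<zero>\<^bsub>F\<^esub>}"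

text \<open>Codewords are functions on \<open>torus_points F\<close>, extended by \<open>undefined\<close>.\<close>

definition toric_code ::
    "('a, 'b) ring_scheme \<Rightarrow> (real ^ 'n::finite) set \<Rightarrow> (('n \<Rightarrow> 'a) \<Rightarrow> 'a) set" where
  "toric_code F P =
     (\<lambda>f. restrict (laurent_eval F f) (torus_points F)) ` global_sections F P"

definition code_length :: "('a, 'b) ring_scheme \<Rightarrow> 'n::finite itself \<Rightarrow> nat" where
  "code_length F _ = card (torus_points F :: ('n \<Rightarrow> 'a) set)"

definition weight :: "('a, 'b) ring_scheme \<Rightarrow> (('n \<Rightarrow> 'a) \<Rightarrow> 'a) \<Rightarrow> nat" where
  "weight F c = card {t \<in> torus_points F. c t \<noteq> \<zero>\<^bsub>F\<^esub>}"

definition nonzero_word :: "('a, 'b) ring_scheme \<Rightarrow> (('n \<Rightarrow> 'a) \<Rightarrow> 'a) \<Rightarrow> bool" where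
  "nonzero_word F c \<longleftrightarrow> (\<exists>t\<in>torus_points F. c t \<noteq> \<zero>\<^bsub>F\<^esub>)"

text \<open>Meaningful only for codes with a nonzero word.\<close>

definition min_distance :: "('a, 'b) ring_scheme \<Rightarrow> (('n \<Rightarrow> 'a) \<Rightarrow> 'a) set \<Rightarrow> nat" where
  "min_distance F C = (LEAST w. \<exists>c\<in>C. nonzero_word F c \<and> w = weight F c)"

definition vol :: "(real ^ 'n) set \<Rightarrow> real" where
  "vol P = measure lebesgue P"


section \<open>Joyner's conjecture\<close>

text \<open>This is the minimum distance bound of the conjecture in dimension \<open>CARD('n)\<close>.
  The threshold \<open>q0\<close> may depend on the variety and the divisor. Since the length \<open>n\<close> grows
  with \<open>q\<close>, the integer \<open>N\<close> is chosen after the field. A finite field has an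
  isomorphic copy with carrier in the integers (an arbitrary set of integers with arbitrary
  operations), so quantifying over \<open>int ring\<close> covers all finite fields. The zero code, which has
  no minimum distance, is excluded.\<close>

definition joyner_conjecture :: "'n::finite itself \<Rightarrow> bool" where
  "joyner_conjecture _ \<longleftrightarrow>
     (\<forall>(\<Delta> :: (real ^ 'n) set set) D.
        complete_fan \<Delta> \<and> smooth_fan \<Delta> \<and> cartier \<Delta> D \<longrightarrow>
        (\<exists>q0. \<forall>F :: int ring. field F \<and> finite (carrier F) \<and> q0 \<le> card (carrier F) \<longrightarrow>
          (let P = divisor_polytope \<Delta> D;
               C = toric_code F P;
               n = code_length F TYPE('n)
           in \<forall>N :: int. N > 1 \<and> 2 * real_of_int N * vol P \<le> real n \<and> real n \<le> 2 * (real_of_int N)\<^sup>2 * vol P \<and>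
                (\<exists>c\<in>C. nonzero_word F c) \<longrightarrow>
                real (min_distance F C) \<ge> real n - 2 * real_of_int N * vol P)))"


section \<open>The toric surface\<close>

definition v1 :: "int ^ 2" where "v1 = vector [1, 0]"
definition v2 :: "int ^ 2" where "v2 = vector [-1, 1]"
definition v3 :: "int ^ 2" where "v3 = vector [-1, 0]"
definition v4 :: "int ^ 2" where "v4 = vector [-1, -1]"

text \<open>The generators are listed in counterclockwise order, so the maximal cones of the complete
  fan are spanned by cyclically consecutive ones.\<close>

definition surface_fan :: "(real ^ 2) set set" where
  "surface_fan = lattice_cone ` {{}, {v1}, {v2}, {v3}, {v4}, {v1, v2}, {v2, v3}, {v3, v4}, {v4, v1}}"

definition surface_divisor :: "2 divisor" where
  "surface_divisor = (\<lambda>w. prime_divisor v3 w + 2 * prime_divisor v4 w)"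

definition lattice_triangle :: "(real ^ 2) set" where
  "lattice_triangle = convex hull {vector [0, 0], vector [1, 1], vector [0, 2]}"

end

theory Submission
  imports Defs "HOL-Number_Theory.Residues"
begin

text \<open>The lattice points of the triangle are \<open>(0,0)\<close>, \<open>(0,1)\<close>, \<open>(0,2)\<close> and \<open>(1,1)\<close>, so a section is
  \<open>f = Q(y) + d x y\<close> with \<open>deg Q \<le> 2\<close>. If \<open>d \<noteq> 0\<close>, each \<open>y\<close> determines at most one zero, giving at
  most \<open>q - 1\<close> zeros; if \<open>d = 0\<close>, the zeros are the at most two roots of \<open>Q\<close> times all \<open>x\<close>. The bound
  \<open>2 (q - 1)\<close> is attained by \<open>(y - 1) (y - g)\<close>, which exceeds the conjectured \<open>2 N\<close> for \<open>N = q - 2\<close>.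
  The fields \<open>\<int>/p\<close> for large primes \<open>p\<close> then refute the conjecture.

  The fan axioms follow from two facts: a nonempty face of a finitely generated cone is generated
  by the generators it contains, and every cone of the fan is spanned by a subset of a lattice
  basis with determinant 1, in which Cramer's rule turns membership into linear inequalities.\<close>

section \<open>Cones generated by lattice vectors\<close>

lemma lattice_cone_empty [simp]: "lattice_cone {} = {0}"
  by (simp add: lattice_cone_def)

lemma convex_cone_lattice_cone: "convex_cone (lattice_cone S)"
  by (simp add: lattice_cone_def convex_cone_convex_cone_hull)

lemma zero_in_lattice_cone [simp]: "0 \<in> lattice_cone S"
  by (simp add: lattice_cone_def convex_cone_hull_contains_0)

lemma rvec_in_lattice_cone: "v \<in> S \<Longrightarrow> rvec v \<in> lattice_cone S"
  by (simp add: lattice_cone_def hull_inc)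

lemma lattice_cone_mono: "S \<subseteq> T \<Longrightarrow> lattice_cone S \<subseteq> lattice_cone T"
  by (simp add: lattice_cone_def hull_mono image_mono)

lemma lattice_cone_subset: "convex_cone K \<Longrightarrow> rvec ` S \<subseteq> K \<Longrightarrow> lattice_cone S \<subseteq> K"
  by (simp add: lattice_cone_def hull_minimal)

lemma in_lattice_cone_single: "x \<in> lattice_cone {v} \<longleftrightarrow> (\<exists>c\<ge>0. x = c *\<^sub>R rvec v)"
  by (auto simp: lattice_cone_def convex_cone_hull_convex_hull_nonempty)

text \<open>The cone hull of a union is the Minkowski sum of the cone hulls. Splitting off one
  generator this way drives the induction on generators in
  \<open>face_of_lattice_cone\<close>.\<close>

lemma in_lattice_cone_insert:
  "x \<in> lattice_cone (insert v S) \<longleftrightarrow> (\<exists>c\<ge>0. \<exists>y\<in>lattice_cone S. x = c *\<^sub>R rvec v + y)"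
proof -
  have "lattice_cone (insert v S) = (\<Union>x\<in>lattice_cone {v}. \<Union>y\<in>lattice_cone S. {x + y})"
    using convex_cone_hull_Un[of "rvec ` {v}" "rvec ` S"] by (simp add: lattice_cone_def)
  then show ?thesis
    by (fastforce simp: in_lattice_cone_single)
qed

lemma in_lattice_cone_pair:
  "x \<in> lattice_cone {v, w} \<longleftrightarrow> (\<exists>s\<ge>0. \<exists>t\<ge>0. x = s *\<^sub>R rvec v + t *\<^sub>R rvec w)"
  unfolding in_lattice_cone_insert[of _ v "{w}"] by (fastforce simp: in_lattice_cone_single)

section \<open>Faces of finitely generated cones\<close>

lemma face_of_convex_cone_summands:
  assumes K: "convex_cone K" and F: "F face_of K"
    and x: "x \<in> K" and y: "y \<in> K" and xy: "x + y \<in> F"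
  shows "x \<in> F \<and> y \<in> F"
proof -
  have "conic F"
    using F K face_of_conic by (auto simp: convex_cone_def)
  then have scale: "c *\<^sub>R z \<in> F" if "z \<in> F" "c \<ge> 0" for c z
    using that by (simp add: conic_def)
  show ?thesis
  proof (cases "x = y")
    case True
    then show ?thesis
      using scale[OF xy, of "1/2"] by (simp add: scaleR_2[symmetric])
  next
    case False
    have mem: "2 *\<^sub>R x \<in> K" "2 *\<^sub>R y \<in> K"
      using K x y by (auto simp: convex_cone_def conic_def)
    \<comment> \<open>Doubling stays inside the cone and exhibits \<open>x + y\<close> as the
      midpoint of a proper segment. The face property then captures both endpoints, and conicity
      allows halving them again.\<close>
    have "x + y = midpoint (2 *\<^sub>R x) (2 *\<^sub>R y)"
      by (simp add: midpoint_def scaleR_right_distrib)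
    then have "x + y \<in> open_segment (2 *\<^sub>R x) (2 *\<^sub>R y)"
      using False by (simp add: midpoint_in_open_segment)
    then have "2 *\<^sub>R x \<in> F" "2 *\<^sub>R y \<in> F"
      using face_ofD[OF F _ mem xy] by auto
    then show ?thesis
      using scale[of "2 *\<^sub>R x" "1/2"] scale[of "2 *\<^sub>R y" "1/2"] by simp
  qed
qed

text \<open>When a point of the face is written as a nonnegative combination of generators, each
  summand lies in the face, so every generator with a positive coefficient does too. This gives
  closure of the fan under faces.\<close>

lemma face_of_lattice_cone:
  assumes S: "finite S" and F: "F face_of lattice_cone S" "F \<noteq> {}"
  shows "F = lattice_cone {v \<in> S. rvec v \<in> F}"
proof
  have conic: "conic F"
    using F convex_cone_lattice_cone face_of_conic by (auto simp: convex_cone_def)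
  \<comment> \<open>The induction shrinks the generating set to \<open>T\<close> but keeps
    \<open>F\<close> a face of the full cone over \<open>S\<close>, since \<open>F\<close> need not
    be contained in the cone over \<open>T\<close>.\<close>
  have "T \<subseteq> S \<Longrightarrow> \<forall>x\<in>lattice_cone T \<inter> F. x \<in> lattice_cone {v \<in> T. rvec v \<in> F}" for T
  proof (induction T rule: infinite_finite_induct)
    case (insert v T)
    show ?case
    proof
      fix x assume x: "x \<in> lattice_cone (insert v T) \<inter> F"
      then obtain c y where c: "c \<ge> 0" and y: "y \<in> lattice_cone T" and xeq: "x = c *\<^sub>R rvec v + y"
        by (auto simp: in_lattice_cone_insert)
      have "c *\<^sub>R rvec v \<in> lattice_cone S"
        using c insert.prems in_lattice_cone_single lattice_cone_mono[of "{v}" S] by blast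
      moreover have "y \<in> lattice_cone S"
        using y insert.prems lattice_cone_mono[of T S] by blast
      ultimately have F': "c *\<^sub>R rvec v \<in> F" "y \<in> F"
        using face_of_convex_cone_summands[OF convex_cone_lattice_cone F(1)] x xeq by auto
      then have y': "y \<in> lattice_cone {w \<in> T. rvec w \<in> F}"
        using insert y by auto
      show "x \<in> lattice_cone {w \<in> insert v T. rvec w \<in> F}"
      proof (cases "c = 0")
        case True
        have "{w \<in> T. rvec w \<in> F} \<subseteq> {w \<in> insert v T. rvec w \<in> F}" by auto
        from lattice_cone_mono[OF this] show ?thesis
          using True y' xeq by auto
      next
        case False
        have "inverse c *\<^sub>R (c *\<^sub>R rvec v) \<in> F"
          using conic F'(1) c unfolding conic_def by (simp del: scaleR_scaleR)
        then have "rvec v \<in> F"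
          using False by simp
        then have "{w \<in> insert v T. rvec w \<in> F} = insert v {w \<in> T. rvec w \<in> F}" by auto
        then show ?thesis
          using c y' xeq by (auto simp: in_lattice_cone_insert)
      qed
    qed
  qed (use S finite_subset in auto)
  then show "F \<subseteq> lattice_cone {v \<in> S. rvec v \<in> F}"
    using F(1) face_of_imp_subset by blast
  have "convex_cone F"
    using F conic face_of_imp_convex by (auto simp: convex_cone_def)
  then show "lattice_cone {v \<in> S. rvec v \<in> F} \<subseteq> F"
    by (rule lattice_cone_subset) auto
qed

text \<open>Proportionality gives v_i w_j = w_i v_j for all j. Taking the gcd over j, primitivity
  yields |v_i| = |w_i|, and positivity of \<open>c\<close> fixes the signs.\<close>

lemma primitive_same_ray:
  assumes v: "primitive v" and w: "primitive w" and eq: "rvec v = c *\<^sub>R rvec w" and c: "c > 0"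
  shows "v = w"
proof (rule vec_eq_iff[THEN iffD2], rule allI)
  fix i
  have co: "real_of_int (v $ j) = c * real_of_int (w $ j)" for j
    using arg_cong[OF eq, of "\<lambda>x. x $ j"] by (simp add: rvec_def)
  have "v $ i * w $ j = w $ i * v $ j" for j
  proof -
    have "real_of_int (v $ i * w $ j) = real_of_int (w $ i * v $ j)"
      by (simp add: co)
    then show ?thesis by (simp only: of_int_eq_iff)
  qed
  then have "(*) (v $ i) ` range (($) w) = (*) (w $ i) ` range (($) v)"
    by (simp add: image_image)
  then have "normalize (v $ i * Gcd (range (($) w))) = normalize (w $ i * Gcd (range (($) v)))"
    by (metis Gcd_mult)
  then have "\<bar>v $ i\<bar> = \<bar>w $ i\<bar>"
    using v w by (simp add: primitive_def)
  moreover have "(v $ i \<ge> 0) = (w $ i \<ge> 0)"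
    using co[of i] c by (metis of_int_0_le_iff zero_le_mult_iff less_le_not_le)
  ultimately show "v $ i = w $ i" by linarith
qed

section \<open>Unimodular pairs in the plane\<close>

lemma rvec_nth [simp]: "rvec v $ i = real_of_int (v $ i)"
  by (simp add: rvec_def)

lemma vec2_eq_iff: "(x :: 'a ^ 2) = y \<longleftrightarrow> x $ 1 = y $ 1 \<and> x $ 2 = y $ 2"
  by (simp add: vec_eq_iff forall_2)

text \<open>Cramer's rule has denominator 1 here, so the coordinates \<open>s\<close> and
  \<open>t\<close> are integers. The same determinant identity forces any other coordinates to agree
  with them.\<close>

lemma lattice_basis_pair:
  fixes a b :: "int ^ 2"
  assumes det: "a $ 1 * b $ 2 - a $ 2 * b $ 1 = 1"
  shows "lattice_basis {a, b}"
  unfolding lattice_basis_def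
proof (intro conjI allI)
  have ab: "a \<noteq> b" using det by auto
  fix u :: "int ^ 2"
  define s t where "s = u $ 1 * b $ 2 - u $ 2 * b $ 1" and "t = a $ 1 * u $ 2 - a $ 2 * u $ 1"
  show "\<exists>!c. (\<forall>v. v \<notin> {a, b} \<longrightarrow> c v = 0) \<and> u = (\<Sum>v\<in>{a, b}. c v *s v)"
  proof (rule ex1I[of _ "\<lambda>v. if v = a then s else if v = b then t else 0"])
    have "u $ i = s * a $ i + t * b $ i" if "i = 1 \<or> i = 2" for i
    proof -
      have "s * a $ i + t * b $ i = u $ i * (a $ 1 * b $ 2 - a $ 2 * b $ 1)"
        using that by (auto simp: s_def t_def algebra_simps)
      then show ?thesis by (simp add: det)
    qed
    then show "(\<forall>v. v \<notin> {a, b} \<longrightarrow> (if v = a then s else if v = b then t else 0) = 0) \<and>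
      u = (\<Sum>v\<in>{a, b}. (if v = a then s else if v = b then t else 0) *s v)"
      using ab by (auto simp: vec2_eq_iff)
  next
    fix c assume c: "(\<forall>v. v \<notin> {a, b} \<longrightarrow> c v = 0) \<and> u = (\<Sum>v\<in>{a, b}. c v *s v)"
    then have "u = c a *s a + c b *s b"
      using ab by simp
    then have "u $ 1 = c a * a $ 1 + c b * b $ 1" "u $ 2 = c a * a $ 2 + c b * b $ 2"
      by simp_all
    then have "s = c a * (a $ 1 * b $ 2 - a $ 2 * b $ 1)"
      "t = c b * (a $ 1 * b $ 2 - a $ 2 * b $ 1)"
      by (simp_all add: s_def t_def algebra_simps)
    then show "c = (\<lambda>v. if v = a then s else if v = b then t else 0)"
      using c by (auto simp: det)
  qed
qed simp

text \<open>Stated as an equivalence so that setting \<open>s\<close> or \<open>t\<close> to zero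
  also yields equations for the two rays and for the origin.\<close>

lemma cramer_rule_2:
  fixes a b :: "int ^ 2" and x :: "real ^ 2"
  assumes det: "a $ 1 * b $ 2 - a $ 2 * b $ 1 = 1"
  shows "x = s *\<^sub>R rvec a + t *\<^sub>R rvec b \<longleftrightarrow>
    s = x $ 1 * b $ 2 - x $ 2 * b $ 1 \<and> t = a $ 1 * x $ 2 - a $ 2 * x $ 1"
    (is "?L \<longleftrightarrow> s = ?s \<and> t = ?t")
proof -
  have rdet: "real_of_int (a $ 1) * real_of_int (b $ 2) - real_of_int (a $ 2) * real_of_int (b $ 1) = 1"
    (is "?d = 1")
    using arg_cong[OF det, of real_of_int] by simp
  show ?thesis
  proof
    assume ?L
    then have "x $ 1 = s * a $ 1 + t * b $ 1" "x $ 2 = s * a $ 2 + t * b $ 2"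
      by simp_all
    then have "?s = s * ?d" "?t = t * ?d"
      by (simp_all add: algebra_simps)
    then show "s = ?s \<and> t = ?t" unfolding rdet by linarith
  next
    assume st: "s = ?s \<and> t = ?t"
    have "x $ i = s * a $ i + t * b $ i" if "i = 1 \<or> i = 2" for i
    proof -
      have "s * a $ i + t * b $ i = x $ i * ?d"
        using that by (auto simp: st algebra_simps)
      then show ?thesis unfolding rdet by linarith
    qed
    from this[of 1] this[of 2] show ?L
      by (simp add: vec2_eq_iff)
  qed
qed

lemma in_lattice_cone_basis_pair:
  fixes a b :: "int ^ 2"
  assumes det: "a $ 1 * b $ 2 - a $ 2 * b $ 1 = 1"
  shows "x \<in> lattice_cone {a, b} \<longleftrightarrow>
    x $ 1 * b $ 2 - x $ 2 * b $ 1 \<ge> 0 \<and> a $ 1 * x $ 2 - a $ 2 * x $ 1 \<ge> 0"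
  unfolding in_lattice_cone_pair cramer_rule_2[OF det] by auto

text \<open>The two Cramer coordinates are linear forms that are nonnegative on the cone. The zero
  line of each one supports the cone and cuts out a ray; the origin is the intersection of these two
  faces.\<close>

lemma face_of_basis_pair_cone:
  fixes a b :: "int ^ 2"
  assumes det: "a $ 1 * b $ 2 - a $ 2 * b $ 1 = 1" and T: "T \<subseteq> {a, b}"
  shows "lattice_cone T face_of lattice_cone {a, b}"
proof -
  have convex: "convex (lattice_cone {a, b})"
    using convex_cone_lattice_cone by (auto simp: convex_cone_def)
  have ray_a: "x \<in> lattice_cone {a} \<longleftrightarrow> x $ 1 * b $ 2 - x $ 2 * b $ 1 \<ge> 0 \<and> a $ 1 * x $ 2 - a $ 2 * x $ 1 = 0" for x
    using cramer_rule_2[OF det, of x _ 0] by (auto simp: in_lattice_cone_single)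
  have ray_b: "x \<in> lattice_cone {b} \<longleftrightarrow> x $ 1 * b $ 2 - x $ 2 * b $ 1 = 0 \<and> a $ 1 * x $ 2 - a $ 2 * x $ 1 \<ge> 0" for x
    using cramer_rule_2[OF det, of x 0] by (auto simp: in_lattice_cone_single)
  \<comment> \<open>The inner product with this normal vector is the coefficient of
    \<open>b\<close>, so it vanishes on the ray of \<open>a\<close>.\<close>
  have "lattice_cone {a, b} \<inter> {x. vector [- real_of_int (a $ 2), real_of_int (a $ 1)] \<bullet> x = 0}
      face_of lattice_cone {a, b}"
    by (rule face_of_Int_supporting_hyperplane_ge[OF convex])
      (auto simp: in_lattice_cone_basis_pair[OF det] inner_vec_def sum_2)
  moreover have "lattice_cone {a, b} \<inter> {x. vector [- real_of_int (a $ 2), real_of_int (a $ 1)] \<bullet> x = 0}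
      = lattice_cone {a}"
    by (auto simp: in_lattice_cone_basis_pair[OF det] ray_a inner_vec_def sum_2)
  ultimately have face_a: "lattice_cone {a} face_of lattice_cone {a, b}" by simp
  have "lattice_cone {a, b} \<inter> {x. vector [real_of_int (b $ 2), - real_of_int (b $ 1)] \<bullet> x = 0}
      face_of lattice_cone {a, b}"
    by (rule face_of_Int_supporting_hyperplane_ge[OF convex])
      (auto simp: in_lattice_cone_basis_pair[OF det] inner_vec_def sum_2 mult.commute)
  moreover have "lattice_cone {a, b} \<inter> {x. vector [real_of_int (b $ 2), - real_of_int (b $ 1)] \<bullet> x = 0}
      = lattice_cone {b}"
    by (auto simp: in_lattice_cone_basis_pair[OF det] ray_b inner_vec_def sum_2 mult.commute)
  ultimately have face_b: "lattice_cone {b} face_of lattice_cone {a, b}" by simp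
  have "lattice_cone {a} \<inter> lattice_cone {b} = {0}"
  proof -
    have "x = 0" if "x \<in> lattice_cone {a}" "x \<in> lattice_cone {b}" for x
      using that cramer_rule_2[OF det, of x 0 0] by (auto simp: ray_a ray_b)
    then show ?thesis by auto
  qed
  then have face_0: "lattice_cone {} face_of lattice_cone {a, b}"
    using face_of_Int[OF face_a face_b] by simp
  have "T = {} \<or> T = {a} \<or> T = {b} \<or> T = {a, b}"
    using T by auto
  then show ?thesis
    using face_0 face_a face_b face_of_refl[OF convex] by auto
qed

text \<open>If \<open>x\<close> and \<open>- x\<close> both lie in the cone, each Cramer coordinate
  of \<open>x\<close> is both nonnegative and nonpositive, hence zero.\<close>

lemma lattice_cone_basis_pair_pointed:
  fixes a b :: "int ^ 2"
  assumes det: "a $ 1 * b $ 2 - a $ 2 * b $ 1 = 1"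
  shows "lattice_cone {a, b} \<inter> uminus ` lattice_cone {a, b} = {0}"
proof -
  have "x = 0" if "x \<in> lattice_cone {a, b}" "- x \<in> lattice_cone {a, b}" for x
    using that cramer_rule_2[OF det, of x 0 0] by (auto simp: in_lattice_cone_basis_pair[OF det])
  moreover have "0 \<in> uminus ` lattice_cone {a, b}"
    by (rule image_eqI[of _ _ 0]) auto
  ultimately show ?thesis by auto
qed

section \<open>The fan and the divisor\<close>

lemma surface_rays_nth [simp]:
  "v1 $ 1 = 1" "v1 $ 2 = 0" "v2 $ 1 = -1" "v2 $ 2 = 1"
  "v3 $ 1 = -1" "v3 $ 2 = 0" "v4 $ 1 = -1" "v4 $ 2 = -1"
  by (simp_all add: v1_def v2_def v3_def v4_def)

lemma surface_rays_distinct [simp]: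
  "v1 \<noteq> v2" "v1 \<noteq> v3" "v1 \<noteq> v4" "v2 \<noteq> v1" "v2 \<noteq> v3" "v2 \<noteq> v4"
  "v3 \<noteq> v1" "v3 \<noteq> v2" "v3 \<noteq> v4" "v4 \<noteq> v1" "v4 \<noteq> v2" "v4 \<noteq> v3"
  by (auto simp: vec2_eq_iff)

text \<open>Each cyclically consecutive pair of rays has determinant 1, so the Cramer inequalities
  apply. They reduce questions about the fan to linear arithmetic in two coordinates.\<close>

lemma in_surface_max_cone:
  "x \<in> lattice_cone {v1, v2} \<longleftrightarrow> x $ 2 \<ge> 0 \<and> x $ 1 + x $ 2 \<ge> 0"
  "x \<in> lattice_cone {v2, v3} \<longleftrightarrow> x $ 2 \<ge> 0 \<and> x $ 1 + x $ 2 \<le> 0"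
  "x \<in> lattice_cone {v3, v4} \<longleftrightarrow> x $ 2 \<le> 0 \<and> x $ 1 \<le> x $ 2"
  "x \<in> lattice_cone {v4, v1} \<longleftrightarrow> x $ 2 \<le> 0 \<and> x $ 1 \<ge> x $ 2"
  by (subst in_lattice_cone_basis_pair; auto)+

lemma in_surface_ray:
  "x \<in> lattice_cone {v1} \<longleftrightarrow> x $ 2 = 0 \<and> x $ 1 \<ge> 0"
  "x \<in> lattice_cone {v2} \<longleftrightarrow> x $ 1 + x $ 2 = 0 \<and> x $ 2 \<ge> 0"
  "x \<in> lattice_cone {v3} \<longleftrightarrow> x $ 2 = 0 \<and> x $ 1 \<le> 0"
  "x \<in> lattice_cone {v4} \<longleftrightarrow> x $ 1 = x $ 2 \<and> x $ 2 \<le> 0"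
proof -
  show "x \<in> lattice_cone {v1} \<longleftrightarrow> x $ 2 = 0 \<and> x $ 1 \<ge> 0"
    by (auto simp: in_lattice_cone_single vec2_eq_iff intro!: exI[of _ "x $ 1"])
  show "x \<in> lattice_cone {v2} \<longleftrightarrow> x $ 1 + x $ 2 = 0 \<and> x $ 2 \<ge> 0"
    by (auto simp: in_lattice_cone_single vec2_eq_iff intro!: exI[of _ "x $ 2"])
  show "x \<in> lattice_cone {v3} \<longleftrightarrow> x $ 2 = 0 \<and> x $ 1 \<le> 0"
    by (auto simp: in_lattice_cone_single vec2_eq_iff intro!: exI[of _ "- x $ 1"])
  show "x \<in> lattice_cone {v4} \<longleftrightarrow> x $ 1 = x $ 2 \<and> x $ 2 \<le> 0"
    by (auto simp: in_lattice_cone_single vec2_eq_iff intro!: exI[of _ "- x $ 1"])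
qed

lemma in_zero_cone: "x \<in> lattice_cone {} \<longleftrightarrow> x $ 1 = 0 \<and> x $ 2 = 0"
  for x :: "real ^ 2"
  by (auto simp: vec2_eq_iff)

lemmas in_surface_cone = in_surface_max_cone in_surface_ray in_zero_cone

text \<open>Working with generating sets instead of cones makes faces correspond to subsets and
  intersections of cones to intersections of sets.\<close>

definition surface_cones :: "(int ^ 2) set set" where
  "surface_cones = {{}, {v1}, {v2}, {v3}, {v4}, {v1, v2}, {v2, v3}, {v3, v4}, {v4, v1}}"

lemma surface_fan_alt: "surface_fan = lattice_cone ` surface_cones"
  by (simp add: surface_fan_def surface_cones_def)

text \<open>This is the simplicial complex of a 4-cycle; written with power sets, its closure under
  subsets is immediate.\<close>

lemma surface_cones_eq:
  "surface_cones = Pow {v1, v2} \<union> Pow {v2, v3} \<union> Pow {v3, v4} \<union> Pow {v4, v1}"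
  unfolding surface_cones_def by (auto simp: Pow_insert)

lemma surface_cones_down: "S \<in> surface_cones \<Longrightarrow> T \<subseteq> S \<Longrightarrow> T \<in> surface_cones"
  unfolding surface_cones_eq by blast

lemma surface_cone_in_basis:
  assumes "S \<in> surface_cones"
  obtains a b where "S \<subseteq> {a, b}" "a $ 1 * b $ 2 - a $ 2 * b $ 1 = 1"
proof -
  have "\<exists>a b. S \<subseteq> {a, b} \<and> a $ 1 * b $ 2 - a $ 2 * b $ 1 = 1"
    using assms unfolding surface_cones_eq
    apply (elim UnE)
    subgoal by (rule exI[of _ v1], rule exI[of _ v2]) auto
    subgoal by (rule exI[of _ v2], rule exI[of _ v3]) auto
    subgoal by (rule exI[of _ v3], rule exI[of _ v4]) auto
    subgoal by (rule exI[of _ v4], rule exI[of _ v1]) auto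
    done
  then show ?thesis using that by blast
qed

text \<open>This reduces the intersection axiom of a fan to generators: the common part of two cones
  is spanned by a subset of either generating set.\<close>

lemma surface_cone_Int:
  assumes "S \<in> surface_cones" "T \<in> surface_cones"
  shows "lattice_cone S \<inter> lattice_cone T = lattice_cone (S \<inter> T)"
proof
  show "lattice_cone (S \<inter> T) \<subseteq> lattice_cone S \<inter> lattice_cone T"
    using lattice_cone_mono[of "S \<inter> T"] by blast
  \<comment> \<open>All 81 ordered pairs are settled by the coordinate descriptions. Removing
    \<open>lattice_cone_empty\<close> from the simplifier keeps the zero cone in a form to which
    \<open>in_zero_cone\<close> applies.\<close>
  have "\<forall>S\<in>surface_cones. \<forall>T\<in>surface_cones.
      x \<in> lattice_cone S \<and> x \<in> lattice_cone T \<longrightarrow> x \<in> lattice_cone (S \<inter> T)" for x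
    unfolding surface_cones_def by (simp add: in_surface_cone del: lattice_cone_empty)
  then show "lattice_cone S \<inter> lattice_cone T \<subseteq> lattice_cone (S \<inter> T)"
    using assms by blast
qed

lemma fan_surface_fan: "fan surface_fan"
  unfolding fan_def
proof (intro conjI ballI allI impI)
  show "finite surface_fan" "surface_fan \<noteq> {}"
    by (simp_all add: surface_fan_def)
next
  fix \<sigma> assume "\<sigma> \<in> surface_fan"
  then obtain S where S: "S \<in> surface_cones" "\<sigma> = lattice_cone S"
    by (auto simp: surface_fan_alt)
  obtain a b where ab: "S \<subseteq> {a, b}" "a $ 1 * b $ 2 - a $ 2 * b $ 1 = 1"
    by (rule surface_cone_in_basis[OF S(1)])
  have fin: "finite S" using ab(1) finite_subset by blast
  then show "\<exists>S. finite S \<and> \<sigma> = lattice_cone S" using S(2) by blast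
  have "\<sigma> \<inter> uminus ` \<sigma> \<subseteq> {0}"
    using lattice_cone_basis_pair_pointed[OF ab(2)] lattice_cone_mono[OF ab(1)] S(2) by blast
  moreover have "0 \<in> \<sigma> \<inter> uminus ` \<sigma>"
    using S(2) by (auto intro: image_eqI[of _ _ 0])
  ultimately show "\<sigma> \<inter> uminus ` \<sigma> = {0}" by blast
  fix \<tau> assume "\<tau> face_of \<sigma> \<and> \<tau> \<noteq> {}"
  then have "\<tau> = lattice_cone {v \<in> S. rvec v \<in> \<tau>}"
    using face_of_lattice_cone[OF fin] S(2) by simp
  moreover have "{v \<in> S. rvec v \<in> \<tau>} \<in> surface_cones"
    using surface_cones_down[OF S(1)] by simp
  ultimately show "\<tau> \<in> surface_fan"
    by (simp add: surface_fan_alt)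
next
  have face: "lattice_cone (S \<inter> T) face_of lattice_cone S" if S: "S \<in> surface_cones" for S T
  proof -
    obtain a b where ab: "S \<subseteq> {a, b}" "a $ 1 * b $ 2 - a $ 2 * b $ 1 = 1"
      by (rule surface_cone_in_basis[OF S])
    \<comment> \<open>A face of the full basis cone remains a face of every intermediate convex set
      containing it, here \<open>lattice_cone S\<close>.\<close>
    have "lattice_cone (S \<inter> T) face_of lattice_cone {a, b}"
      using ab by (intro face_of_basis_pair_cone) auto
    then show ?thesis
      by (rule face_of_subset) (use ab in \<open>auto intro!: lattice_cone_mono\<close>)
  qed
  fix \<sigma> \<tau> assume "\<sigma> \<in> surface_fan" "\<tau> \<in> surface_fan"
  then obtain S T where ST: "S \<in> surface_cones" "T \<in> surface_cones"
      and eq: "\<sigma> = lattice_cone S" "\<tau> = lattice_cone T"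
    by (auto simp: surface_fan_alt)
  have "\<sigma> \<inter> \<tau> = lattice_cone (S \<inter> T)"
    unfolding eq using ST by (rule surface_cone_Int)
  then show "\<sigma> \<inter> \<tau> face_of \<sigma>" "\<sigma> \<inter> \<tau> face_of \<tau>"
    using face[OF ST(1), of T] face[OF ST(2), of S] unfolding eq Int_commute[of T S] by metis+
qed

lemma complete_fan_surface_fan: "complete_fan surface_fan"
proof -
  have "x \<in> lattice_cone {v1, v2} \<or> x \<in> lattice_cone {v2, v3} \<or>
      x \<in> lattice_cone {v3, v4} \<or> x \<in> lattice_cone {v4, v1}" for x
    unfolding in_surface_max_cone by linarith
  then have "x \<in> \<Union>surface_fan" for x
    unfolding surface_fan_def Union_iff by (metis image_eqI insertCI)
  then show ?thesis
    using fan_surface_fan unfolding complete_fan_def by blast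
qed

lemma smooth_fan_surface_fan: "smooth_fan surface_fan"
  unfolding smooth_fan_def
proof (intro conjI fan_surface_fan ballI)
  fix \<sigma> assume "\<sigma> \<in> surface_fan"
  then obtain S where S: "S \<in> surface_cones" "\<sigma> = lattice_cone S"
    by (auto simp: surface_fan_alt)
  obtain a b where ab: "S \<subseteq> {a, b}" "a $ 1 * b $ 2 - a $ 2 * b $ 1 = 1"
    by (rule surface_cone_in_basis[OF S(1)])
  show "\<exists>B S. lattice_basis B \<and> S \<subseteq> B \<and> \<sigma> = lattice_cone S"
    by (intro exI[of _ "{a, b}"] exI[of _ S] conjI lattice_basis_pair ab S(2))
qed

lemma primitive_surface_rays: "v \<in> {v1, v2, v3, v4} \<Longrightarrow> primitive v"
  unfolding primitive_def by (auto simp: UNIV_2)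

lemma ray_generators_surface_fan: "ray_generators surface_fan = {v1, v2, v3, v4}"
proof
  show "{v1, v2, v3, v4} \<subseteq> ray_generators surface_fan"
    using primitive_surface_rays by (auto simp: ray_generators_def surface_fan_def)
  show "ray_generators surface_fan \<subseteq> {v1, v2, v3, v4}"
  proof
    fix v assume "v \<in> ray_generators surface_fan"
    then have v: "primitive v" "lattice_cone {v} \<in> surface_fan"
      by (auto simp: ray_generators_def)
    then obtain S where S: "S \<in> surface_cones" "lattice_cone {v} = lattice_cone S"
      by (auto simp: surface_fan_alt)
    have v0: "rvec v \<noteq> 0"
      using v(1) by (auto simp: primitive_def vec2_eq_iff UNIV_2)
    \<comment> \<open>Every generator in \<open>S\<close> lies on the ray of \<open>v\<close>, and
      \<open>S\<close> is nonempty because \<open>rvec v\<close> is nonzero. So one of the four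
      listed vectors is a positive multiple of \<open>v\<close>, and primitivity makes them
      equal.\<close>
    have Sv: "\<exists>c>0. rvec w = c *\<^sub>R rvec v" if "w \<in> S" "rvec w \<noteq> 0" for w
      using rvec_in_lattice_cone[OF that(1)] S(2) that(2)
      by (metis in_lattice_cone_single less_eq_real_def scaleR_zero_left)
    have vS: "rvec v \<in> lattice_cone S"
      using rvec_in_lattice_cone[of v "{v}"] S(2) by simp
    then have "S \<noteq> {}" using v0 by auto
    then obtain w where w: "w \<in> S" by blast
    have "w \<in> {v1, v2, v3, v4}"
      using w S(1) by (auto simp: surface_cones_def)
    moreover from this have "rvec w \<noteq> 0"
      by (auto simp: vec2_eq_iff)
    then have "w = v"
      using Sv[OF w] primitive_same_ray[OF primitive_surface_rays v(1)] calculation by blast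
    ultimately show "v \<in> {v1, v2, v3, v4}" by simp
  qed
qed

text \<open>The local characters are the vertices of the triangle. The vertex (1,1) serves both
  maximal cones containing \<open>v3\<close>, because the supporting line belonging to
  \<open>v3\<close> meets the triangle only there.\<close>

lemma cartier_surface_divisor: "cartier surface_fan surface_divisor"
proof -
  have D: "surface_divisor v1 = 0" "surface_divisor v2 = 0"
    "surface_divisor v3 = 1" "surface_divisor v4 = 2"
    by (simp_all add: surface_divisor_def prime_divisor_def)
  have "\<exists>m :: int ^ 2. \<forall>v\<in>{v1, v2, v3, v4}. rvec v \<in> lattice_cone S \<longrightarrow>
      (\<Sum>i\<in>UNIV. m $ i * v $ i) = - surface_divisor v" if S: "S \<in> surface_cones" for S
  proof -
    \<comment> \<open>A smaller cone contains fewer rays, so it inherits the character of any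
      maximal cone around it.\<close>
    have character: ?thesis
      if "S \<subseteq> T" and m: "\<forall>v\<in>{v1, v2, v3, v4}. rvec v \<in> lattice_cone T \<longrightarrow>
        m $ 1 * v $ 1 + m $ 2 * v $ 2 = - surface_divisor v" for T and m :: "int ^ 2"
      using m lattice_cone_mono[OF that(1)] by (intro exI[of _ m]) (auto simp: sum_2)
    consider "S \<subseteq> {v1, v2}" | "S \<subseteq> {v2, v3}" | "S \<subseteq> {v3, v4}" | "S \<subseteq> {v4, v1}"
      using S unfolding surface_cones_eq Un_iff Pow_iff by metis
    then show ?thesis
    proof cases
      case 1
      then show ?thesis
        by (rule character[of _ "vector [0, 0]"]) (auto simp: in_surface_cone D)
    next
      case 2
      then show ?thesis
        by (rule character[of _ "vector [1, 1]"]) (auto simp: in_surface_cone D)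
    next
      case 3
      then show ?thesis
        by (rule character[of _ "vector [1, 1]"]) (auto simp: in_surface_cone D)
    next
      case 4
      then show ?thesis
        by (rule character[of _ "vector [0, 2]"]) (auto simp: in_surface_cone D)
    qed
  qed
  then show ?thesis
    unfolding cartier_def ray_generators_surface_fan unfolding surface_fan_alt by blast
qed

section \<open>The polytope of the divisor and its area\<close>

lemma in_divisor_polytope_surface:
  "u \<in> divisor_polytope surface_fan surface_divisor \<longleftrightarrow> 0 \<le> u $ 1 \<and> u $ 1 \<le> u $ 2 \<and> u $ 1 + u $ 2 \<le> 2"
  unfolding divisor_polytope_def ray_generators_surface_fan
  by (auto simp: surface_divisor_def prime_divisor_def inner_vec_def sum_2)

lemma in_lattice_triangle:
  "u \<in> lattice_triangle \<longleftrightarrow> 0 \<le> u $ 1 \<and> u $ 1 \<le> u $ 2 \<and> u $ 1 + u $ 2 \<le> 2"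
proof
  assume "u \<in> lattice_triangle"
  then show "0 \<le> u $ 1 \<and> u $ 1 \<le> u $ 2 \<and> u $ 1 + u $ 2 \<le> 2"
    by (auto simp: lattice_triangle_def convex_hull_3)
next
  assume u: "0 \<le> u $ 1 \<and> u $ 1 \<le> u $ 2 \<and> u $ 1 + u $ 2 \<le> 2"
  \<comment> \<open>Barycentric weights of (1,1) and (0,2), obtained by solving u = s (1,1) + t
    (0,2).\<close>
  define s t where "s = u $ 1" and "t = (u $ 2 - u $ 1) / 2"
  have "u = (1 - s - t) *\<^sub>R vector [0, 0] + s *\<^sub>R vector [1, 1] + t *\<^sub>R vector [0, 2]"
    unfolding vec2_eq_iff by (simp add: s_def t_def field_simps)
  moreover have "0 \<le> 1 - s - t" "0 \<le> s" "0 \<le> t" "1 - s - t + s + t = 1"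
    using u by (simp_all add: s_def t_def field_simps)
  ultimately show "u \<in> lattice_triangle"
    unfolding lattice_triangle_def convex_hull_3 by blast
qed

lemma divisor_polytope_surface: "divisor_polytope surface_fan surface_divisor = lattice_triangle"
  using in_divisor_polytope_surface in_lattice_triangle by blast

lemma vol_lattice_triangle: "vol lattice_triangle = 1"
proof -
  \<comment> \<open>Borel measurability allows passing from the completed measure in
    \<open>vol\<close> to \<open>lborel\<close>, for which \<open>content_triangle\<close> gives the
    area.\<close>
  have "lattice_triangle \<in> sets lborel"
    unfolding lattice_triangle_def sets_lborel
    by (intro borel_compact finite_imp_compact_convex_hull) simp
  then have "vol lattice_triangle = measure lborel lattice_triangle"
    by (simp add: vol_def)
  then show ?thesis
    by (simp add: lattice_triangle_def content_triangle)
qed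

section \<open>The code\<close>

text \<open>Torus points are functions on the index type \<open>2\<close>; as pairs they can be
  counted through a cartesian product.\<close>

lemma bij_betw_torus_points_2:
  "bij_betw (\<lambda>t. (t 1, t 2)) (torus_points F :: (2 \<Rightarrow> 'a) set)
     ((carrier F - {\<zero>\<^bsub>F\<^esub>}) \<times> (carrier F - {\<zero>\<^bsub>F\<^esub>}))"
proof (rule bij_betw_byWitness[where f' = "\<lambda>(x, y) i. if i = 1 then x else y"])
  show "\<forall>t\<in>torus_points F. (case (t 1, t 2) of (x, y) \<Rightarrow> \<lambda>i :: 2. if i = 1 then x else y) = t"
    using exhaust_2 by fastforce
qed (auto simp: torus_points_def split: if_splits)

lemma card_torus_points_2:
  "card {t \<in> torus_points F. P (t (1 :: 2)) (t 2)} =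
   card {z \<in> (carrier F - {\<zero>\<^bsub>F\<^esub>}) \<times> (carrier F - {\<zero>\<^bsub>F\<^esub>}). P (fst z) (snd z)}"
proof (rule bij_betw_same_card)
  show "bij_betw (\<lambda>t. (t 1, t 2)) {t \<in> torus_points F. P (t (1 :: 2)) (t 2)}
      {z \<in> (carrier F - {\<zero>\<^bsub>F\<^esub>}) \<times> (carrier F - {\<zero>\<^bsub>F\<^esub>}). P (fst z) (snd z)}"
    using bij_betw_torus_points_2 by (rule bij_betw_Collect) simp
qed

lemma finite_torus_points_2: "finite (carrier F) \<Longrightarrow> finite (torus_points F :: (2 \<Rightarrow> 'a) set)"
  using bij_betw_finite[OF bij_betw_torus_points_2, of F] by simp

lemma code_length_2:
  assumes "finite (carrier F)" "\<zero>\<^bsub>F\<^esub> \<in> carrier F"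
  shows "code_length F TYPE(2) = (card (carrier F) - 1)\<^sup>2"
  using bij_betw_same_card[OF bij_betw_torus_points_2, of F] assms
  by (simp add: code_length_def card_cartesian_product power2_eq_square)

section \<open>Sections and their evaluation\<close>

definition triangle_points :: "(int ^ 2) set" where
  "triangle_points = {vector [0, 0], vector [0, 1], vector [0, 2], vector [1, 1]}"

lemma rvec_in_lattice_triangle: "rvec u \<in> lattice_triangle \<longleftrightarrow> u \<in> triangle_points"
proof
  assume "rvec u \<in> lattice_triangle"
  then have "0 \<le> u $ 1" "u $ 1 \<le> u $ 2" "u $ 1 + u $ 2 \<le> 2"
    unfolding in_lattice_triangle rvec_nth by linarith+
  then have "u $ 1 = 0 \<and> u $ 2 = 0 \<or> u $ 1 = 0 \<and> u $ 2 = 1 \<or> u $ 1 = 0 \<and> u $ 2 = 2 \<or>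
      u $ 1 = 1 \<and> u $ 2 = 1"
    by presburger
  then show "u \<in> triangle_points"
    unfolding triangle_points_def vec2_eq_iff insert_iff empty_iff vector_2 by argo
qed (auto simp: triangle_points_def in_lattice_triangle)

lemma triangle_points_distinct:
  "vector [0, 0] \<noteq> (vector [0, 1] :: int ^ 2)" "vector [0, 0] \<noteq> (vector [0, 2] :: int ^ 2)"
  "vector [0, 0] \<noteq> (vector [1, 1] :: int ^ 2)" "vector [0, 1] \<noteq> (vector [0, 2] :: int ^ 2)"
  "vector [0, 1] \<noteq> (vector [1, 1] :: int ^ 2)" "vector [0, 2] \<noteq> (vector [1, 1] :: int ^ 2)"
  by (simp_all add: vec2_eq_iff)

context field
begin

lemma monomial_at_triangle:
  assumes "t \<in> torus_points R"
  shows "monomial_at R (vector [0, 0]) t = \<one>"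
    and "monomial_at R (vector [0, 1]) t = t (2 :: 2)"
    and "monomial_at R (vector [0, 2]) t = t 2 \<otimes> t 2"
    and "monomial_at R (vector [1, 1]) t = t 1 \<otimes> t 2"
proof -
  have t: "t i \<in> carrier R" for i
    using assms by (simp add: torus_points_def)
  have "(1 :: 2) \<noteq> 2" by simp
  then show "monomial_at R (vector [0, 0]) t = \<one>"
    and "monomial_at R (vector [0, 1]) t = t (2 :: 2)"
    and "monomial_at R (vector [0, 2]) t = t 2 \<otimes> t 2"
    and "monomial_at R (vector [1, 1]) t = t 1 \<otimes> t 2"
    using t by (simp_all add: monomial_at_def UNIV_2 int_pow_def2 numeral_2_eq_2)
qed

lemma laurent_eval_triangle:
  assumes f: "f \<in> global_sections R lattice_triangle" and t: "t \<in> torus_points R"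
  shows "laurent_eval R f t =
    (f (vector [0, 0]) \<oplus> f (vector [0, 1]) \<otimes> t 2 \<oplus> f (vector [0, 2]) \<otimes> (t 2 \<otimes> t 2)) \<oplus>
     f (vector [1, 1]) \<otimes> (t 1 \<otimes> t 2)"
proof -
  have fc: "f u \<in> carrier R" for u
    using f by (simp add: global_sections_def)
  have tc: "t i \<in> carrier R" for i
    using t by (simp add: torus_points_def)
  have sub: "{u. f u \<noteq> \<zero>} \<subseteq> triangle_points"
    using f by (auto simp: global_sections_def rvec_in_lattice_triangle)
  have mc: "monomial_at R u t \<in> carrier R" if "u \<in> triangle_points" for u
    using that tc by (auto simp: triangle_points_def monomial_at_triangle[OF t])
  \<comment> \<open>The defining sum runs over the support of \<open>f\<close>. Adding the lattice
    points with zero coefficient replaces it by a fixed index set of four exponents.\<close>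
  have "laurent_eval R f t = (\<Oplus>u\<in>triangle_points. f u \<otimes> monomial_at R u t)"
    unfolding laurent_eval_def
    by (rule add.finprod_mono_neutral_cong_left)
      (use sub fc mc in \<open>auto simp: triangle_points_def\<close>)
  also have "\<dots> = (f (vector [0, 0]) \<oplus> f (vector [0, 1]) \<otimes> t 2 \<oplus> f (vector [0, 2]) \<otimes> (t 2 \<otimes> t 2)) \<oplus>
     f (vector [1, 1]) \<otimes> (t 1 \<otimes> t 2)"
    using fc tc
    by (simp add: triangle_points_def triangle_points_distinct monomial_at_triangle[OF t] a_assoc)
  finally show ?thesis .
qed

section \<open>Counting zeros on the torus\<close>

lemma quadratic_two_roots:
  assumes [simp]: "a \<in> carrier R" "b \<in> carrier R" "c \<in> carrier R" "x \<in> carrier R" "y \<in> carrier R"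
    and x: "a \<oplus> b \<otimes> x \<oplus> c \<otimes> (x \<otimes> x) = \<zero>" and y: "a \<oplus> b \<otimes> y \<oplus> c \<otimes> (y \<otimes> y) = \<zero>" and xy: "x \<noteq> y"
  shows "b \<oplus> c \<otimes> (x \<oplus> y) = \<zero>"
proof -
  \<comment> \<open>The difference of the two values factors into x - y and the divided difference
    of the quadratic; x - y is nonzero and cancels.\<close>
  have "(x \<ominus> y) \<otimes> (b \<oplus> c \<otimes> (x \<oplus> y)) =
      (a \<oplus> b \<otimes> x \<oplus> c \<otimes> (x \<otimes> x)) \<ominus> (a \<oplus> b \<otimes> y \<oplus> c \<otimes> (y \<otimes> y))"
    using assms(1-5) by algebra
  also have "\<dots> = \<zero>" using x y by (simp add: minus_eq)
  finally show ?thesis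
    using xy by (simp add: integral_iff)
qed

text \<open>Three distinct roots give two divided differences sharing \<open>x\<close>. Comparing
  them forces \<open>c\<close> to vanish, then \<open>b\<close>, then \<open>a\<close>. There is no
  division by 2, so characteristic 2 is covered.\<close>

lemma card_quadratic_roots_le:
  assumes c: "a \<in> carrier R" "b \<in> carrier R" "c \<in> carrier R" and nz: "\<not> (a = \<zero> \<and> b = \<zero> \<and> c = \<zero>)"
  shows "card {y \<in> carrier R. a \<oplus> b \<otimes> y \<oplus> c \<otimes> (y \<otimes> y) = \<zero>} \<le> 2" (is "card ?Z \<le> 2")
proof (rule ccontr)
  assume "\<not> card ?Z \<le> 2"
  then have "3 \<le> card ?Z" by simp
  from ex_card[OF this] obtain S where S: "S \<subseteq> ?Z" "card S = 3"
    by (elim exE conjE) (rule that)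
  obtain x y z where S3: "S = {x, y, z}" "x \<noteq> y" "x \<noteq> z" "y \<noteq> z"
    using S(2) unfolding card_3_iff by blast
  have "x \<in> ?Z" "y \<in> ?Z" "z \<in> ?Z"
    by (rule subsetD[OF S(1)], simp add: S3(1))+
  then have [simp]: "x \<in> carrier R" "y \<in> carrier R" "z \<in> carrier R"
    and eq: "a \<oplus> b \<otimes> x \<oplus> c \<otimes> (x \<otimes> x) = \<zero>" "a \<oplus> b \<otimes> y \<oplus> c \<otimes> (y \<otimes> y) = \<zero>"
      "a \<oplus> b \<otimes> z \<oplus> c \<otimes> (z \<otimes> z) = \<zero>"
    by simp_all
  note [simp] = c
  have 1: "b \<oplus> c \<otimes> (x \<oplus> y) = \<zero>" and 2: "b \<oplus> c \<otimes> (x \<oplus> z) = \<zero>"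
    using quadratic_two_roots[OF c _ _ eq(1,2) S3(2)] quadratic_two_roots[OF c _ _ eq(1,3) S3(3)]
    by simp_all
  then have "b \<oplus> c \<otimes> (x \<oplus> y) = b \<oplus> c \<otimes> (x \<oplus> z)" by simp
  then have "c \<otimes> (x \<oplus> y) = c \<otimes> (x \<oplus> z)" by simp
  then have "c = \<zero>"
    using S3(4) m_lcancel[of c "x \<oplus> y" "x \<oplus> z"] by auto
  moreover from this 1 have "b = \<zero>" by simp
  ultimately show False using eq(1) nz by simp
qed

text \<open>Nontriviality is expressed by a nonzero value instead of a nonzero coefficient. This
  matches nonzero codewords directly and avoids the question whether evaluation is
  injective.\<close>

lemma card_triangle_zeros_le:
  assumes fin: "finite (carrier R)" and f: "f \<in> global_sections R lattice_triangle"
    and t0: "t0 \<in> torus_points R" "laurent_eval R f t0 \<noteq> \<zero>"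
  shows "card {t \<in> torus_points R. laurent_eval R f t = \<zero>} \<le> 2 * (card (carrier R) - 1)"
proof -
  define a b c d where "a = f (vector [0, 0])" and "b = f (vector [0, 1])"
    and "c = f (vector [0, 2])" and "d = f (vector [1, 1])"
  have [simp]: "a \<in> carrier R" "b \<in> carrier R" "c \<in> carrier R" "d \<in> carrier R"
    using f by (simp_all add: global_sections_def a_def b_def c_def d_def)
  define K where "K = carrier R - {\<zero>}"
  have K: "finite K" "card K = card (carrier R) - 1" "\<And>x. x \<in> K \<Longrightarrow> x \<in> carrier R"
    using fin by (simp_all add: K_def)
  define Q where "Q y = a \<oplus> b \<otimes> y \<oplus> c \<otimes> (y \<otimes> y)" for y
  have Qc [simp]: "Q y \<in> carrier R" if "y \<in> carrier R" for y
    using that by (simp add: Q_def)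
  define Z where "Z = {z \<in> K \<times> K. Q (snd z) \<oplus> d \<otimes> (fst z \<otimes> snd z) = \<zero>}"
  have eval: "laurent_eval R f t = Q (t 2) \<oplus> d \<otimes> (t 1 \<otimes> t 2)" if "t \<in> torus_points R" for t
    using laurent_eval_triangle[OF f that] by (simp add: Q_def a_def b_def c_def d_def)
  have "{t \<in> torus_points R. laurent_eval R f t = \<zero>} =
      {t \<in> torus_points R. Q (t 2) \<oplus> d \<otimes> (t 1 \<otimes> t 2) = \<zero>}"
    using eval by auto
  then have cardZ: "card {t \<in> torus_points R. laurent_eval R f t = \<zero>} = card Z"
    unfolding Z_def K_def
    using card_torus_points_2[of R "\<lambda>x y. Q y \<oplus> d \<otimes> (x \<otimes> y) = \<zero>"] by simp
  have "card Z \<le> 2 * card K"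
  proof (cases "d = \<zero>")
    case False
    have "inj_on snd Z"
    proof (rule inj_onI)
      fix z w assume zw: "z \<in> Z" "w \<in> Z" "snd z = snd w"
      obtain x x' y where z: "z = (x, y)" and w: "w = (x', y)"
        using zw(3) by (metis prod.collapse)
      have xy: "x \<in> carrier R" "x' \<in> carrier R" "y \<in> carrier R" "y \<noteq> \<zero>"
        using zw(1,2) by (auto simp: z w Z_def K_def)
      have "Q y \<oplus> d \<otimes> (x \<otimes> y) = Q y \<oplus> d \<otimes> (x' \<otimes> y)"
        using zw(1,2) by (simp add: z w Z_def)
      then have "d \<otimes> (x \<otimes> y) = d \<otimes> (x' \<otimes> y)"
        using xy by simp
      then have "x = x'"
        using xy False by (simp add: m_lcancel m_rcancel)
      then show "z = w" by (simp add: z w)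
    qed
    moreover have "snd ` Z \<subseteq> K" by (auto simp: Z_def)
    ultimately have "card Z \<le> card K"
      using K(1) card_inj_on_le by blast
    then show ?thesis by simp
  next
    case True
    \<comment> \<open>If the quadratic part vanished along with \<open>d\<close>, the section would
      be zero everywhere, contradicting its value at \<open>t0\<close>.\<close>
    have nz: "\<not> (a = \<zero> \<and> b = \<zero> \<and> c = \<zero>)"
    proof
      assume "a = \<zero> \<and> b = \<zero> \<and> c = \<zero>"
      moreover have "t0 i \<in> carrier R" for i
        using t0(1) by (simp add: torus_points_def)
      ultimately show False
        using t0 True by (simp add: eval Q_def)
    qed
    let ?Y = "{y \<in> carrier R. Q y = \<zero>}"
    have "Z \<subseteq> K \<times> ?Y"
      using K(3) by (auto simp: Z_def True)
    then have "card Z \<le> card (K \<times> ?Y)"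
      using fin K(1) by (intro card_mono) auto
    also have "\<dots> = card K * card ?Y" by (simp add: card_cartesian_product)
    also have "\<dots> \<le> card K * 2"
      using card_quadratic_roots_le[of a b c] nz by (simp add: Q_def)
    finally show ?thesis by simp
  qed
  then show ?thesis using cardZ K(2) by simp
qed

lemma ex_triangle_section_max_zeros:
  assumes fin: "finite (carrier R)" and q: "card (carrier R) \<ge> 3"
  shows "\<exists>f\<in>global_sections R lattice_triangle.
    card {t \<in> torus_points R. laurent_eval R f t = \<zero>} = 2 * (card (carrier R) - 1)"
proof -
  \<comment> \<open>At least three elements are required for a second nonzero root \<open>g\<close>
    besides 1.\<close>
  have "\<not> carrier R \<subseteq> {\<zero>, \<one>}"
    using card_mono[of "{\<zero>, \<one>}" "carrier R"] q by auto
  then obtain g where g: "g \<in> carrier R" "g \<noteq> \<zero>" "g \<noteq> \<one>"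
    by blast
  \<comment> \<open>The coefficients of (y - 1)(y - g) = y^2 - (1 + g) y + g, with y the second
    torus coordinate.\<close>
  define f where "f u = (if u = vector [0, 0] then g else if u = vector [0, 1] then \<ominus> (\<one> \<oplus> g)
    else if u = vector [0, 2] then \<one> else \<zero>)" for u :: "int ^ 2"
  have supp: "{u. f u \<noteq> \<zero>} \<subseteq> triangle_points"
    by (auto simp: f_def triangle_points_def)
  have "finite {u. f u \<noteq> \<zero>}"
    using supp by (rule finite_subset) (simp add: triangle_points_def)
  then have f: "f \<in> global_sections R lattice_triangle"
    using supp g by (auto simp: global_sections_def rvec_in_lattice_triangle f_def)
  have coeffs: "f (vector [0, 0]) = g" "f (vector [0, 1]) = \<ominus> (\<one> \<oplus> g)"
    "f (vector [0, 2]) = \<one>" "f (vector [1, 1]) = \<zero>"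
    using triangle_points_distinct by (auto simp: f_def)
  define K where "K = carrier R - {\<zero>}"
  have "laurent_eval R f t = \<zero> \<longleftrightarrow> t 2 \<in> {\<one>, g}" if t: "t \<in> torus_points R" for t
  proof -
    have tc [simp]: "t i \<in> carrier R" for i
      using t by (simp add: torus_points_def)
    have "laurent_eval R f t = g \<oplus> (\<ominus> (\<one> \<oplus> g)) \<otimes> t 2 \<oplus> t 2 \<otimes> t 2"
      using g by (simp add: laurent_eval_triangle[OF f t] coeffs)
    also have "\<dots> = (t 2 \<ominus> \<one>) \<otimes> (t 2 \<ominus> g)"
      using g(1) tc[of 2] by algebra
    finally show ?thesis
      using g by (simp add: integral_iff)
  qed
  then have "{t \<in> torus_points R. laurent_eval R f t = \<zero>} = {t \<in> torus_points R. t 2 \<in> {\<one>, g}}"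
    by blast
  then have "card {t \<in> torus_points R. laurent_eval R f t = \<zero>} =
      card {z \<in> K \<times> K. snd z \<in> {\<one>, g}}"
    unfolding K_def using card_torus_points_2[of R "\<lambda>x y. y \<in> {\<one>, g}"] by simp
  also have "{z \<in> K \<times> K. snd z \<in> {\<one>, g}} = K \<times> {\<one>, g}"
    using g by (auto simp: K_def)
  also have "card (K \<times> {\<one>, g}) = 2 * (card (carrier R) - 1)"
    using g fin by (simp add: card_cartesian_product K_def)
  finally show ?thesis using f by blast
qed

lemma weight_toric_code_2:
  fixes f :: "int ^ 2 \<Rightarrow> 'a"
  assumes fin: "finite (carrier R)"
  shows "weight R (restrict (laurent_eval R f) (torus_points R)) =
    (card (carrier R) - 1)\<^sup>2 - card {t \<in> torus_points R. laurent_eval R f t = \<zero>}" 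
    (is "weight R ?c = _ - card ?Z")
proof -
  have "{t \<in> torus_points R. ?c t \<noteq> \<zero>} = torus_points R - ?Z" by auto
  moreover have "card (torus_points R - ?Z) = card (torus_points R :: (2 \<Rightarrow> 'a) set) - card ?Z"
    using finite_torus_points_2[OF fin] by (intro card_Diff_subset) auto
  ultimately show ?thesis
    using code_length_2[OF fin] by (simp add: weight_def code_length_def)
qed

lemma min_distance_triangle:
  assumes fin: "finite (carrier R)" and q: "card (carrier R) \<ge> 4"
  shows "min_distance R (toric_code R lattice_triangle) =
      (card (carrier R) - 1)\<^sup>2 - 2 * (card (carrier R) - 1)"
    and "\<exists>c\<in>toric_code R lattice_triangle. nonzero_word R c"
proof -
  let ?q = "card (carrier R)"
  let ?w = "\<lambda>f. restrict (laurent_eval R f) (torus_points R)"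
  let ?d = "(?q - 1)\<^sup>2 - 2 * (?q - 1)"
  obtain f where f: "f \<in> global_sections R lattice_triangle"
    "card {t \<in> torus_points R. laurent_eval R f t = \<zero>} = 2 * (?q - 1)"
    using ex_triangle_section_max_zeros[OF fin] q by auto
  have w: "?w f \<in> toric_code R lattice_triangle" "weight R (?w f) = ?d"
    using f by (auto simp: toric_code_def weight_toric_code_2[OF fin])
  \<comment> \<open>Here \<open>?q \<ge> 4\<close> enters: the number of zeros stays below the size
    of the torus, so the extremal section gives a nonzero word. At q = 3 both sides would be
    4.\<close>
  have "2 * (?q - 1) < (?q - 1)\<^sup>2"
    using q by (simp add: power2_eq_square)
  then have "weight R (?w f) \<noteq> 0"
    using w(2) by simp
  then have "{t \<in> torus_points R. ?w f t \<noteq> \<zero>} \<noteq> {}"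
    unfolding weight_def by (metis card.empty)
  then have nz: "nonzero_word R (?w f)"
    by (auto simp: nonzero_word_def)
  show "\<exists>c\<in>toric_code R lattice_triangle. nonzero_word R c"
    using nz w(1) by blast
  show "min_distance R (toric_code R lattice_triangle) = ?d"
    unfolding min_distance_def
  proof (rule Least_equality)
    show "\<exists>c\<in>toric_code R lattice_triangle. nonzero_word R c \<and> ?d = weight R c"
      using nz w by force
    fix k assume "\<exists>c\<in>toric_code R lattice_triangle. nonzero_word R c \<and> k = weight R c"
    then obtain h where h: "h \<in> global_sections R lattice_triangle" "nonzero_word R (?w h)"
        "k = weight R (?w h)"
      by (auto simp: toric_code_def)
    from h(2) obtain t0 where "t0 \<in> torus_points R" "laurent_eval R h t0 \<noteq> \<zero>"
      by (auto simp: nonzero_word_def)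
    from card_triangle_zeros_le[OF fin h(1) this] show "?d \<le> k"
      by (simp add: h(3) weight_toric_code_2[OF fin] diff_le_mono2)
  qed
qed

end

section \<open>Code parameters and the failure of the conjecture\<close>

lemma surface_toric_code:
  fixes F :: "'a ring"
  assumes F: "field F" "finite (carrier F)" and card: "card (carrier F) = q" and q: "q \<ge> 5"
  defines "C \<equiv> toric_code F lattice_triangle" and "n \<equiv> code_length F TYPE(2)" and "N \<equiv> int q - 2"
  shows "n = (q - 1)\<^sup>2" "\<exists>c\<in>C. nonzero_word F c" "N > 1"
    "2 * real_of_int N \<le> real n" "real n \<le> 2 * (real_of_int N)\<^sup>2"
    "int (min_distance F C) = (int q - 1)\<^sup>2 - 2 * (int q - 1)"
    "real (min_distance F C) < real n - 2 * real_of_int N"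
proof -
  interpret F: field F by fact
  \<comment> \<open>With q = k + 5 no truncated subtraction remains: n = (k + 4)^2, N = k + 3, and
    every claim compares polynomials in k.\<close>
  obtain k where k: "q = k + 5"
    using q le_Suc_ex by (metis add.commute)
  show n: "n = (q - 1)\<^sup>2"
    using code_length_2[OF F(2)] card by (simp add: n_def)
  show "\<exists>c\<in>C. nonzero_word F c"
    using F.min_distance_triangle(2)[OF F(2)] card q by (simp add: C_def)
  show "N > 1" using q by (simp add: N_def)
  \<comment> \<open>The upper estimate is the one that forces q to be at least 5: at q = 4 one has n
    = 9 but 2 N^2 = 8.\<close>
  show "2 * real_of_int N \<le> real n" "real n \<le> 2 * (real_of_int N)\<^sup>2"
    by (simp_all add: n N_def k power2_eq_square algebra_simps)
  have d: "min_distance F C = (q - 1)\<^sup>2 - 2 * (q - 1)"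
    using F.min_distance_triangle(1)[OF F(2)] card q by (simp add: C_def)
  also have "\<dots> = k * k + 6 * k + 8"
    by (simp add: k power2_eq_square algebra_simps)
  finally have d: "min_distance F C = k * k + 6 * k + 8" .
  \<comment> \<open>Since n - 2 N = k^2 + 6 k + 10, the conjectured bound exceeds the distance by
    exactly 2 for every q.\<close>
  show "int (min_distance F C) = (int q - 1)\<^sup>2 - 2 * (int q - 1)"
    "real (min_distance F C) < real n - 2 * real_of_int N"
    by (simp_all add: d n N_def k power2_eq_square algebra_simps)
qed

lemma not_joyner_conjecture: "\<not> joyner_conjecture TYPE(2)"
proof
  assume "joyner_conjecture TYPE(2)"
  then obtain q0 where q0: "\<And>F :: int ring. \<And>N :: int. field F \<Longrightarrow> finite (carrier F) \<Longrightarrow> q0 \<le> card (carrier F) \<Longrightarrow>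
      N > 1 \<Longrightarrow> 2 * real_of_int N \<le> real (code_length F TYPE(2)) \<Longrightarrow>
      real (code_length F TYPE(2)) \<le> 2 * (real_of_int N)\<^sup>2 \<Longrightarrow>
      \<exists>c\<in>toric_code F lattice_triangle. nonzero_word F c \<Longrightarrow>
      real (min_distance F (toric_code F lattice_triangle)) \<ge>
        real (code_length F TYPE(2)) - 2 * real_of_int N"
    unfolding joyner_conjecture_def Let_def
    using complete_fan_surface_fan smooth_fan_surface_fan cartier_surface_divisor
      divisor_polytope_surface vol_lattice_triangle
    by (metis mult_1_right)
  \<comment> \<open>The threshold \<open>q0\<close> is already fixed, so a prime field beyond it
    suffices. The ring of residues modulo p has its carrier in the integers, as the formal
    conjecture demands.\<close>
  obtain p :: nat where p: "prime p" "max q0 5 < p"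
    using bigger_prime by blast
  let ?F = "residue_ring (int p)"
  interpret residues_prime p ?F
    using p(1) by (simp add: residues_prime_def)
  have F: "field ?F" "finite (carrier ?F)" "card (carrier ?F) = p" "p \<ge> 5"
    using is_field finite p(2) by (simp_all add: res_carrier_eq)
  show False
    using q0[OF F(1,2), of "int p - 2"] surface_toric_code[OF F] p(2) F(3) by force
qed

theorem mainTheorem3:
  shows
    "complete_fan surface_fan \<and> smooth_fan surface_fan \<and>
     ray_generators surface_fan = {v1, v2, v3, v4} \<and>
     cartier surface_fan surface_divisor \<and>
     divisor_polytope surface_fan surface_divisor = lattice_triangle \<and>
     vol (divisor_polytope surface_fan surface_divisor) = 1 \<and>
     (\<forall>(F :: 'a ring) q. field F \<and> finite (carrier F) \<and> card (carrier F) = q \<and> q \<ge> 5 \<longrightarrow>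
        (let P = divisor_polytope surface_fan surface_divisor;
             C = toric_code F P;
             n = code_length F TYPE(2);
             d = min_distance F C;
             N = int q - 2
         in n = (q - 1)\<^sup>2 \<and> (\<exists>c\<in>C. nonzero_word F c) \<and>
            N > 1 \<and>
            2 * real_of_int N * vol P \<le> real n \<and>
            real n \<le> 2 * (real_of_int N)\<^sup>2 * vol P \<and>
            int d = (int q - 1)\<^sup>2 - 2 * (int q - 1) \<and>
            real d < real n - 2 * real_of_int N * vol P)) \<and>
     \<not> joyner_conjecture TYPE(2)"
proof (intro conjI)
  show "vol (divisor_polytope surface_fan surface_divisor) = 1"
    by (simp add: divisor_polytope_surface vol_lattice_triangle)
  show "\<forall>(F :: 'a ring) q. field F \<and> finite (carrier F) \<and> card (carrier F) = q \<and> q \<ge> 5 \<longrightarrow>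
        (let P = divisor_polytope surface_fan surface_divisor;
             C = toric_code F P;
             n = code_length F TYPE(2);
             d = min_distance F C;
             N = int q - 2
         in n = (q - 1)\<^sup>2 \<and> (\<exists>c\<in>C. nonzero_word F c) \<and>
            N > 1 \<and>
            2 * real_of_int N * vol P \<le> real n \<and>
            real n \<le> 2 * (real_of_int N)\<^sup>2 * vol P \<and>
            int d = (int q - 1)\<^sup>2 - 2 * (int q - 1) \<and>
            real d < real n - 2 * real_of_int N * vol P)"
    unfolding Let_def divisor_polytope_surface vol_lattice_triangle mult_1_right
    by (intro allI impI; elim conjE; intro conjI; rule surface_toric_code; assumption)
qed (fact complete_fan_surface_fan smooth_fan_surface_fan ray_generators_surface_fan
    cartier_surface_divisor divisor_polytope_surface not_joyner_conjecture)+

end
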